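(* Let $f \in E$ and let $\kappa$ be an ordinal. Then $\Phi(\Psi_f^{\lfloor \kappa \rfloor}(f)) \sqsubseteq f$ implies $\mathrm{lfp}\,\Phi \sqsubseteq f$.
   Context: $(E, \sqsubseteq)$ is a complete lattice (every subset has a greatest lower bound/meet and a least upper bound/join; binary meet written $\sqcap$), and $\Phi\colon E \to E$ is a monotonic operator with least fixed point $\mathrm{lfp}\,\Phi$. For $f \in E$, the $\kappa$-induction operator is $\Psi_f\colon E \to E$, $g \mapsto \Phi(g) \sqcap f$. The lower $\delta$-fold iteration is defined by transfinite recursion: $\Psi_f^{\lfloor 0 \rfloor}(g) = g$; $\Psi_f^{\lfloor \gamma+1 \rfloor}(g) = \Psi_f(\Psi_f^{\lfloor \gamma \rfloor}(g))$; and for a limit ordinal $\delta$, $\Psi_f^{\lfloor \delta \rfloor}(g)$ is the greatest lower bound (meet) of $\{\Psi_f^{\lfloor \gamma \rfloor}(g) \mid \gamma < \delta\}$. All ordinals are tacitly assumed smaller than a fixed ambient ordinal $\nu$ (the smallest ordinal with $|\nu| > |E|$). *)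

theory Defs
  imports Main
begin

text \<open>
  An ordinal below the order type of a well-order \<open>r\<close> is represented by an element of
  \<open>Field r\<close>: the element \<open>k\<close> stands for the order type of its initial segment
  \<open>underS r k\<close>. The ambient ordinal is the least ordinal whose cardinality exceeds that of the
  lattice. The library's \<open>cardSuc\<close> realises it on the type \<open>'a set\<close>; that the elements of its
  field happen to be sets of lattice elements is immaterial.
\<close>

definition ambient_ord :: "'a set rel"
  where "ambient_ord = cardSuc (card_of (UNIV :: 'a set))"

text \<open>\<open>k\<close> is the successor of \<open>j\<close>, in von Neumann style: \<open>k = j \<union> {j}\<close>.\<close>

definition is_ord_succ :: "'o rel \<Rightarrow> 'o \<Rightarrow> 'o \<Rightarrow> bool"
  where "is_ord_succ r j k \<longleftrightarrow> j \<in> underS r k \<and> underS r k = insert j (underS r j)"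

definition iter_step :: "'o rel \<Rightarrow> ('a::complete_lattice \<Rightarrow> 'a) \<Rightarrow> 'a \<Rightarrow> ('o \<Rightarrow> 'a) \<Rightarrow> 'o \<Rightarrow> 'a"
  where "iter_step r F g h k =
    (if underS r k = {} then g
     else if \<exists>j. is_ord_succ r j k then F (h (THE j. is_ord_succ r j k))
     else (INF j\<in>underS r k. h j))"

definition lower_iter :: "'o rel \<Rightarrow> ('a::complete_lattice \<Rightarrow> 'a) \<Rightarrow> 'o \<Rightarrow> 'a \<Rightarrow> 'a"
  where "lower_iter r F k g = wo_rel.worec r (iter_step r F g) k"

definition kind_op :: "('a::complete_lattice \<Rightarrow> 'a) \<Rightarrow> 'a \<Rightarrow> 'a \<Rightarrow> 'a"
  where "kind_op \<Phi> f g = inf (\<Phi> g) f"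

lemma Card_order_ambient_ord: "Card_order (ambient_ord :: 'a set rel)"
  unfolding ambient_ord_def by (rule cardSuc_Card_order[OF card_of_Card_order])

lemma Well_order_ambient_ord: "Well_order (ambient_ord :: 'a set rel)"
  by (rule card_order_on_well_order_on[OF Card_order_ambient_ord])

lemma card_less_ambient_ord:
  "ordLess2 (card_of (UNIV :: 'a set)) (card_of (Field (ambient_ord :: 'a set rel)))"
proof -
  have "ordLess2 (card_of (UNIV :: 'a set)) (ambient_ord :: 'a set rel)"
    unfolding ambient_ord_def by (rule cardSuc_greater[OF card_of_Card_order])
  moreover have "ordIso2 (ambient_ord :: 'a set rel) (card_of (Field (ambient_ord :: 'a set rel)))"
    by (rule ordIso_symmetric[OF card_of_Field_ordIso[OF Card_order_ambient_ord]])
  ultimately show ?thesis by (rule ordLess_ordIso_trans)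
qed

lemma ambient_ord_least:
  assumes "Well_order r" and "ordLess2 (card_of (UNIV :: 'a set)) (card_of (Field r))"
  shows "ordLeq3 (ambient_ord :: 'a set rel) r"
proof -
  have "ordLeq3 (ambient_ord :: 'a set rel) (card_of (Field r))"
    unfolding ambient_ord_def
    by (rule cardSuc_least[OF card_of_Card_order card_of_Card_order assms(2)])
  moreover have "ordLeq3 (card_of (Field r)) r"
    by (rule card_of_least[OF assms(1)])
  ultimately show ?thesis by (rule ordLeq_transitive)
qed

lemma is_ord_succ_unique:
  assumes "Well_order r" "is_ord_succ r i k" "is_ord_succ r j k"
  shows "i = j"
proof (rule ccontr)
  assume "i \<noteq> j"
  have "i \<in> insert j (underS r j)" "j \<in> insert i (underS r i)"
    using assms(2,3) unfolding is_ord_succ_def by metis+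
  with \<open>i \<noteq> j\<close> have "i \<in> underS r j" "j \<in> underS r i" by simp_all
  then have "(i, j) \<in> r" "(j, i) \<in> r" by (simp_all add: underS_def)
  then show False
    using \<open>i \<noteq> j\<close> assms(1) unfolding order_on_defs antisym_def by blast
qed

lemma lower_iter_unfold:
  fixes r :: "'o rel" and F :: "'a::complete_lattice \<Rightarrow> 'a"
  assumes "Well_order r"
  shows "lower_iter r F k g = iter_step r F g (\<lambda>j. lower_iter r F j g) k"
proof -
  interpret wo_rel r using assms by (simp add: wo_rel_def)
  have "adm_wo (iter_step r F g)"
    unfolding adm_wo_def
  proof (intro allI impI)
    fix u v :: "'o \<Rightarrow> 'a" and x
    assume eq: "\<forall>y\<in>underS x. u y = v y"
    have "(THE j. is_ord_succ r j x) \<in> underS x" if "is_ord_succ r j x" for j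
    proof -
      have "(THE j. is_ord_succ r j x) = j"
        using that is_ord_succ_unique[OF assms] by blast
      then show ?thesis using that by (simp add: is_ord_succ_def)
    qed
    moreover have "(INF y\<in>underS x. u y) = (INF y\<in>underS x. v y)"
      using eq by (intro INF_cong) simp_all
    ultimately show "iter_step r F g u x = iter_step r F g v x"
      using eq unfolding iter_step_def by (simp split: if_split) metis
  qed
  then show ?thesis
    unfolding lower_iter_def by (rule fun_cong[OF worec_fixpoint])
qed

lemma lower_iter_zero:
  assumes "Well_order r" "underS r k = {}"
  shows "lower_iter r F k g = g"
  by (subst lower_iter_unfold[OF assms(1)]) (simp add: iter_step_def assms)

lemma lower_iter_succ:
  assumes "Well_order r" "is_ord_succ r j k"
  shows "lower_iter r F k g = F (lower_iter r F j g)"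
proof -
  have "(THE j. is_ord_succ r j k) = j"
    using assms(2) is_ord_succ_unique[OF assms(1)] by (intro the_equality)
  moreover have "\<exists>j. is_ord_succ r j k"
    using assms(2) by (rule exI)
  moreover have "underS r k \<noteq> {}"
    using assms(2) unfolding is_ord_succ_def by blast
  ultimately show ?thesis
    by (subst lower_iter_unfold[OF assms(1)]) (simp add: iter_step_def)
qed

lemma lower_iter_limit:
  assumes "Well_order r" "underS r k \<noteq> {}" "\<nexists>j. is_ord_succ r j k"
  shows "lower_iter r F k g = (INF j\<in>underS r k. lower_iter r F j g)"
  by (subst lower_iter_unfold[OF assms(1)]) (simp add: iter_step_def assms)

end

theory Submission
  imports Defs
begin

text \<open>
  Every iterate of \<open>kind_op \<Phi> f\<close> started at \<open>f\<close> is again a pre-fixed point of \<open>kind_op \<Phi> f\<close>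
  below \<open>f\<close>. If moreover \<open>\<Phi>\<close> maps such an iterate below \<open>f\<close>, then the meet with \<open>f\<close> is
  redundant, so the iterate is a pre-fixed point of \<open>\<Phi>\<close> and Park induction applies.
\<close>

text \<open>Transfinite induction with the ordinals hidden: it suffices that \<open>P\<close> is
  closed under \<open>F\<close> and under nonempty meets.\<close>

lemma lower_iter_induct [consumes 1, case_names zero succ limit]:
  assumes wo: "Well_order r"
    and zero: "P g"
    and succ: "\<And>x. P x \<Longrightarrow> P (F x)"
    and limit: "\<And>X. X \<noteq> {} \<Longrightarrow> (\<And>x. x \<in> X \<Longrightarrow> P x) \<Longrightarrow> P (Inf X)"
  shows "P (lower_iter r F k g)"
proof -
  interpret wo_rel r using wo by (simp add: wo_rel_def)
  show ?thesis
  proof (induction k rule: well_order_induct)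
    case (1 k)
    then have IH: "P (lower_iter r F j g)" if "j \<in> underS k" for j
      using that by (simp add: underS_def)
    \<comment> \<open>An index outside the field of \<open>r\<close> also has no predecessors and
      falls under the first case.\<close>
    consider "underS k = {}" | j where "is_ord_succ r j k"
      | "underS k \<noteq> {}" "\<nexists>j. is_ord_succ r j k"
      by blast
    then show ?case
    proof cases
      case 1
      then show ?thesis by (simp add: lower_iter_zero[OF wo] zero)
    next
      case 2
      then have "j \<in> underS k" by (simp add: is_ord_succ_def)
      then show ?thesis
        unfolding lower_iter_succ[OF wo 2] by (intro succ IH)
    next
      case 3
      then show ?thesis
        unfolding lower_iter_limit[OF wo 3] by (intro limit) (auto intro: IH)
    qed
  qed
qed

lemma mono_kind_op:
  assumes "mono \<Phi>"
  shows "mono (kind_op \<Phi> f)"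
  using assms by (auto simp: mono_def kind_op_def intro: le_infI1)

text \<open>Pre-fixed points of a monotone map are closed under the map and under meets, so the
  induction never compares two iterates.\<close>

lemma lower_iter_prefixed_point:
  assumes wo: "Well_order r" and F: "mono F" and g: "F g \<le> g"
  shows "F (lower_iter r F k g) \<le> lower_iter r F k g"
  using wo
proof (induction rule: lower_iter_induct)
  case zero
  show ?case by (rule g)
next
  case (succ x)
  then show ?case by (rule monoD[OF F])
next
  case (limit X)
  show ?case
  proof (rule Inf_greatest)
    fix x assume "x \<in> X"
    then have "F (Inf X) \<le> F x" by (intro monoD[OF F] Inf_lower)
    also have "\<dots> \<le> x" using limit(2) \<open>x \<in> X\<close> .
    finally show "F (Inf X) \<le> x" .
  qed
qed

lemma lower_iter_kind_op_le:
  assumes "Well_order r"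
  shows "lower_iter r (kind_op \<Phi> f) k f \<le> f"
  using assms
  \<comment> \<open>At a limit, nonemptiness of the family matters: the empty meet is
    \<open>top\<close>.\<close>
  by (induction rule: lower_iter_induct) (auto simp: kind_op_def intro: Inf_lower2)

theorem theorem2:
  fixes \<Phi> :: "'a::complete_lattice \<Rightarrow> 'a" and f :: 'a and \<kappa> :: "'a set"
  assumes "mono \<Phi>"
    and "\<kappa> \<in> Field (ambient_ord :: 'a set rel)"
    and "\<Phi> (lower_iter ambient_ord (kind_op \<Phi> f) \<kappa> f) \<le> f"
  shows "lfp \<Phi> \<le> f"
proof -
  let ?x = "lower_iter ambient_ord (kind_op \<Phi> f) \<kappa> f"
  have "\<Phi> ?x = kind_op \<Phi> f ?x"
    using assms(3) by (simp add: kind_op_def inf_absorb1)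
  also have "\<dots> \<le> ?x"
    \<comment> \<open>The start \<open>f\<close> is a pre-fixed point since
      \<open>kind_op \<Phi> f\<close> takes only values below \<open>f\<close>.\<close>
    by (rule lower_iter_prefixed_point[OF Well_order_ambient_ord mono_kind_op[OF assms(1)]])
      (simp add: kind_op_def)
  finally have "lfp \<Phi> \<le> ?x" by (rule lfp_lowerbound)
  also have "\<dots> \<le> f" by (rule lower_iter_kind_op_le[OF Well_order_ambient_ord])
  finally show ?thesis .
qed

end
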